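(* Let $f_c(z)=z^2+c$ with $c\notin\mathcal M$. Then $\mathbb P^1\setminus\mathcal J_c$ does not admit a bounded injective holomorphic function.
   Context: $\mathcal J_c$ denotes the Julia set of the polynomial $f_c(z)=z^2+c$, and $\mathcal M$ denotes the Mandelbrot set (the set of $c\in\mathbb C$ for which the orbit of $0$ under $f_c$ is bounded); for $c\notin\mathcal M$, $\mathcal J_c$ is a Cantor set. *)

theory Defs
  imports "HOL-Analysis.Analysis"
begin

definition quad_map :: "complex \<Rightarrow> complex \<Rightarrow> complex" where
  "quad_map c z = z^2 + c"

definition filled_julia :: "complex \<Rightarrow> complex set" where
  "filled_julia c = {z. bounded (range (\<lambda>n. (quad_map c ^^ n) z))}"

definition julia :: "complex \<Rightarrow> complex set" where
  "julia c = frontier (filled_julia c)"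

definition mandelbrot :: "complex set" where
  "mandelbrot = {c. bounded (range (\<lambda>n. (quad_map c ^^ n) 0))}"

text \<open>Riemann sphere modelled as complex option, None being the point at infinity.
  Chart at infinity: w maps to 1/w, with 0 mapping to infinity.\<close>
definition chart_inf :: "complex \<Rightarrow> complex option" where
  "chart_inf w = (if w = 0 then None else Some (inverse w))"

definition sphere_holomorphic_on :: "(complex option \<Rightarrow> complex) \<Rightarrow> complex option set \<Rightarrow> bool" where
  "sphere_holomorphic_on f U \<longleftrightarrow>
     (\<lambda>z. f (Some z)) holomorphic_on {z. Some z \<in> U} \<and>
     (None \<in> U \<longrightarrow> (\<lambda>w. f (chart_inf w)) holomorphic_on {w. chart_inf w \<in> U})"

end

theory Submission
  imports Defs "HOL-Complex_Analysis.Complex_Analysis"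
begin

text \<open>
  Write \<open>q\<close> for \<open>quad_map c\<close>. Since the critical orbit escapes, some \<open>V = (q ^^ K) -` ball 0 \<rho>\<close> is
  simply connected, misses the critical value \<open>c\<close> and contains its preimage under \<open>q\<close>; so all inverse
  branches of all iterates of \<open>q\<close> are defined on \<open>V\<close>. Their images of one fixed ring in \<open>V\<close> are
  pairwise disjoint, and those of level \<open>n\<close> surround discs that cover the Julia set.

  Let \<open>f\<close> be univalent and bounded off the Julia set. The \<open>f\<close>-images of all rings are disjoint, so the
  total area of those of level \<open>n\<close> tends to \<open>0\<close>. By Bloch's theorem, the \<open>f\<close>-image of the core curve
  of a ring lies in a disc whose area is at most a constant times the area of the image of the ring.
  If a value \<open>f z0\<close> taken near infinity were outside all discs of level \<open>n\<close>, then replacing \<open>f\<close> inside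
  the core curves by continuous extensions with values in the discs would give a continuous map from
  the sphere to the plane that takes the value \<open>f z0\<close> only at \<open>z0\<close>, and with nonzero derivative there.
  This is impossible: the winding number of the image of a circle around \<open>z0\<close> would be \<open>1\<close> for small
  and \<open>0\<close> for large radii. So the discs of level \<open>n\<close> cover the \<open>f\<close>-image of a fixed neighbourhood of
  infinity, although their total area tends to \<open>0\<close>.
\<close>

section \<open>Diameters and areas\<close>

text \<open>The distances from \<open>x\<close> to the points of \<open>X\<close> fill an interval, and each ball covers a part of
  length at most \<open>2 * M\<close> of it.\<close>
lemma dist_le_connected_finite_cover:
  fixes X :: "'a::metric_space set"
  assumes "connected X" "finite I" and cover: "X \<subseteq> (\<Union>i\<in>I. cball (a i) M)" and xy: "x \<in> X" "y \<in> X"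
  shows "dist x y \<le> 2 * real (card I) * M"
proof -
  have "0 \<le> M"
    using cover xy(1) by (meson UN_E mem_cball order_trans subsetD zero_le_dist)
  define L where "L i = {dist x (a i) - M .. dist x (a i) + M}" for i
  have "connected (dist x ` X)"
    using assms(1) by (intro connected_continuous_image continuous_intros)
  moreover have "0 \<in> dist x ` X" "dist x y \<in> dist x ` X"
    using xy by force+
  ultimately have "{0..dist x y} \<subseteq> dist x ` X"
    by (rule connected_contains_Icc)
  also have "\<dots> \<subseteq> (\<Union>i\<in>I. L i)"
  proof clarify
    fix z
    assume "z \<in> X"
    then obtain i where i: "i \<in> I" "dist (a i) z \<le> M"
      using cover by auto
    have "dist x (a i) - dist (a i) z \<le> dist x z" "dist x z \<le> dist x (a i) + dist (a i) z"
      by metric+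
    then show "dist x z \<in> (\<Union>i\<in>I. L i)"
      using i by (intro UN_I[of i]) (auto simp: L_def)
  qed
  finally have "measure lborel {0..dist x y} \<le> measure lborel (\<Union>i\<in>I. L i)"
    using \<open>finite I\<close>
    by (intro measure_mono_fmeasurable fmeasurable_compact compact_UN) (auto simp: L_def)
  also have "\<dots> \<le> (\<Sum>i\<in>I. measure lborel (L i))"
    using \<open>finite I\<close> by (intro measure_UNION_le) (auto simp: L_def)
  also have "\<dots> = 2 * real (card I) * M"
    using \<open>0 \<le> M\<close> by (simp add: L_def)
  finally show ?thesis
    by simp
qed

lemma norm_deriv_le_area:
  assumes hol: "F holomorphic_on S" and "0 < \<epsilon>" "ball z \<epsilon> \<subseteq> S"
    and meas: "F ` S \<in> fmeasurable lborel"
  shows "norm (deriv F z) \<le> 12 / \<epsilon> * sqrt (measure lborel (F ` S) / pi)"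
proof -
  define d where "d = \<epsilon> * norm (deriv F z) / 12"
  have "d \<ge> 0"
    using assms by (simp add: d_def)
  obtain b where "ball b d \<subseteq> F ` ball z \<epsilon>"
    using Bloch[of F z \<epsilon> d] hol assms holomorphic_on_subset unfolding d_def by blast
  then have "measure lborel (ball b d) \<le> measure lborel (F ` S)"
    using meas assms(3) by (intro measure_mono_fmeasurable) auto
  then have "pi * d ^ 2 \<le> measure lborel (F ` S)"
    using content_ball[OF \<open>d \<ge> 0\<close>, of b] by (simp add: unit_ball_vol_2)
  then have "d \<le> sqrt (measure lborel (F ` S) / pi)"
    by (intro real_le_rsqrt) (simp add: field_simps)
  then show ?thesis
    using assms(2) by (simp add: d_def field_simps)
qed

lemma dist_image_le_area:
  assumes hol: "F holomorphic_on S" and "open S" and sub: "ball x (2 * \<epsilon>) \<subseteq> S" and y: "y \<in> ball x \<epsilon>"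
    and meas: "F ` S \<in> fmeasurable lborel"
  shows "dist (F x) (F y) \<le> 12 * sqrt (measure lborel (F ` S) / pi)"
proof -
  let ?m = "sqrt (measure lborel (F ` S) / pi)"
  have "0 < \<epsilon>"
    using y by (simp add: le_less_trans[OF zero_le_dist])
  have ball_S: "ball z \<epsilon> \<subseteq> S" if "z \<in> ball x \<epsilon>" for z
  proof -
    have "ball z \<epsilon> \<subseteq> ball x (2 * \<epsilon>)"
      using that by (intro subsetI) (simp, metric)
    then show ?thesis
      using sub by blast
  qed
  have "norm (F y - F x) \<le> 12 / \<epsilon> * ?m * norm (y - x)"
  proof (rule field_differentiable_bound[of "ball x \<epsilon>" F "deriv F"])
    fix z
    assume z: "z \<in> ball x \<epsilon>"
    have "z \<in> S"
      using ball_S[OF z] \<open>0 < \<epsilon>\<close> by auto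
    then show "(F has_field_derivative deriv F z) (at z within ball x \<epsilon>)"
      using hol \<open>open S\<close> holomorphic_derivI by blast
    show "norm (deriv F z) \<le> 12 / \<epsilon> * ?m"
      by (rule norm_deriv_le_area[OF hol \<open>0 < \<epsilon>\<close> ball_S[OF z] meas])
  qed (use y \<open>0 < \<epsilon>\<close> in auto)
  also have "\<dots> \<le> 12 / \<epsilon> * ?m * \<epsilon>"
    using y \<open>0 < \<epsilon>\<close> by (intro mult_left_mono) (auto simp: dist_norm norm_minus_commute)
  finally show ?thesis
    using \<open>0 < \<epsilon>\<close> by (simp add: dist_norm norm_minus_commute)
qed

lemma dist_image_connected_le_area:
  assumes hol: "F holomorphic_on S" and "open S" and meas: "F ` S \<in> fmeasurable lborel"
    and "connected G" "G \<subseteq> S" and "finite N" and cover: "G \<subseteq> (\<Union>a\<in>N. ball a \<epsilon>)"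
    and balls: "\<And>a. a \<in> N \<Longrightarrow> ball a (2 * \<epsilon>) \<subseteq> S" and xy: "x \<in> G" "y \<in> G"
  shows "dist (F x) (F y) \<le> 24 * real (card N) * sqrt (measure lborel (F ` S) / pi)"
proof -
  let ?m = "sqrt (measure lborel (F ` S) / pi)"
  have "connected (F ` G)"
    using \<open>connected G\<close> \<open>G \<subseteq> S\<close> hol holomorphic_on_imp_continuous_on holomorphic_on_subset
    by (intro connected_continuous_image) blast+
  moreover have "F ` G \<subseteq> (\<Union>a\<in>N. cball (F a) (12 * ?m))"
  proof clarify
    fix z
    assume "z \<in> G"
    then obtain a where a: "a \<in> N" "z \<in> ball a \<epsilon>"
      using cover by blast
    then show "F z \<in> (\<Union>a\<in>N. cball (F a) (12 * ?m))"
      using dist_image_le_area[OF hol \<open>open S\<close> balls[OF a(1)] a(2) meas] by auto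
  qed
  ultimately have "dist (F x) (F y) \<le> 2 * real (card N) * (12 * ?m)"
    using \<open>finite N\<close> xy by (intro dist_le_connected_finite_cover[of "F ` G"]) auto
  then show ?thesis
    by simp
qed

lemma image_subset_cball_area:
  fixes S G :: "complex set"
  assumes "open S" "compact G" "connected G" "G \<subseteq> S"
  obtains C where "\<And>F. \<lbrakk>F holomorphic_on S; F ` S \<in> fmeasurable lborel\<rbrakk>
    \<Longrightarrow> \<exists>p r. 0 \<le> r \<and> F ` G \<subseteq> cball p r \<and> measure lborel (cball p r) \<le> C * measure lborel (F ` S)"
proof -
  obtain \<delta> where "0 < \<delta>" and \<delta>: "(\<Union>x\<in>G. ball x \<delta>) \<subseteq> S"
    using compact_subset_open_imp_ball_epsilon_subset assms by metis
  define \<epsilon> where "\<epsilon> = \<delta> / 2"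
  have "0 < \<epsilon>"
    using \<open>0 < \<delta>\<close> by (simp add: \<epsilon>_def)
  then obtain N where N: "N \<subseteq> G" "finite N" "G \<subseteq> (\<Union>a\<in>N. ball a \<epsilon>)"
    using compactE_image[OF assms(2), of G "\<lambda>a. ball a \<epsilon>"]
    by (metis UN_I centre_in_ball open_ball subsetI)
  have balls: "ball a (2 * \<epsilon>) \<subseteq> S" if "a \<in> N" for a
    using \<delta> N(1) that by (auto simp: \<epsilon>_def)
  show ?thesis
  proof
    fix F
    assume F: "F holomorphic_on S" "F ` S \<in> fmeasurable lborel"
    define r where "r = 24 * real (card N) * sqrt (measure lborel (F ` S) / pi)"
    have "0 \<le> r"
      by (simp add: r_def)
    have "dist (F x) (F y) \<le> r" if "x \<in> G" "y \<in> G" for x y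
      unfolding r_def
      by (rule dist_image_connected_le_area[OF F(1) assms(1) F(2) assms(3,4) N(2,3) balls that])
    then obtain p where "F ` G \<subseteq> cball p r"
      by (cases "G = {}") (simp, metis all_not_in_conv image_subsetI mem_cball)
    moreover have "measure lborel (cball p r) \<le> (24 * real (card N))\<^sup>2 * measure lborel (F ` S)"
      using content_cball[OF \<open>0 \<le> r\<close>, of p] by (simp add: unit_ball_vol_2 r_def power_mult_distrib)
    ultimately show "\<exists>p r. 0 \<le> r \<and> F ` G \<subseteq> cball p r \<and>
        measure lborel (cball p r) \<le> (24 * real (card N))\<^sup>2 * measure lborel (F ` S)"
      using \<open>0 \<le> r\<close> by blast
  qed
qed

lemma measure_open_pos:
  fixes S :: "'a::euclidean_space set"
  assumes "open S" "bounded S" "S \<noteq> {}"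
  shows "0 < measure lborel S"
proof -
  obtain x r where "0 < r" "ball x r \<subseteq> S"
    using assms open_contains_ball by (metis all_not_in_conv)
  have "0 < measure lborel (ball x r)"
    using \<open>0 < r\<close> by (rule content_ball_pos)
  also have "\<dots> \<le> measure lborel S"
    using assms \<open>ball x r \<subseteq> S\<close>
    by (intro measure_mono_fmeasurable fmeasurableI emeasure_bounded_finite) auto
  finally show ?thesis .
qed

section \<open>Continuous maps of the sphere to the plane\<close>

lemma winding_number_affine:
  assumes "a \<noteq> 0" "valid_path \<gamma>" "z \<notin> path_image \<gamma>"
  shows "winding_number ((\<lambda>w. a * w + b) \<circ> \<gamma>) (a * z + b) = winding_number \<gamma> z"
proof -
  let ?f = "\<lambda>w. a * w + b"
  have hol: "?f holomorphic_on UNIV"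
    by (intro holomorphic_intros)
  then have "valid_path (?f \<circ> \<gamma>)"
    using assms(2) by (intro valid_path_compose_holomorphic[where S = UNIV]) auto
  moreover have "?f z \<notin> path_image (?f \<circ> \<gamma>)"
    using assms by (auto simp: path_image_compose)
  moreover have
    "contour_integral (?f \<circ> \<gamma>) (\<lambda>w. 1 / (w - ?f z)) = contour_integral \<gamma> (\<lambda>w. 1 / (w - z))"
  proof -
    have "deriv ?f w * (1 / (?f w - ?f z)) = 1 / (w - z)" for w
    proof -
      have "deriv ?f w = a"
        by (rule DERIV_imp_deriv) (auto intro!: derivative_eq_intros)
      moreover have "?f w - ?f z = a * (w - z)"
        by (simp add: algebra_simps)
      ultimately show ?thesis
        using assms(1) by simp
    qed
    moreover have "?f analytic_on UNIV"
      using hol by (simp add: analytic_on_open)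
    ultimately show ?thesis
      using contour_integral_comp_analyticW[of ?f UNIV \<gamma>] assms(2) by simp
  qed
  ultimately show ?thesis
    using assms by (simp add: winding_number_valid_path)
qed

lemma circlepath_in_sphere:
  assumes "0 \<le> r" "t \<in> {0..1}"
  shows "circlepath z r t \<in> sphere z r"
proof -
  have "circlepath z r t \<in> path_image (circlepath z r)"
    using assms(2) by (simp add: path_image_def)
  then show ?thesis
    using assms(1) by simp
qed

lemma DERIV_linear_approximation:
  fixes F :: "'a::real_normed_field \<Rightarrow> 'a"
  assumes "(F has_field_derivative d) (at z0)" "d \<noteq> 0"
  obtains \<delta> where "0 < \<delta>"
    "\<And>z. \<lbrakk>z \<noteq> z0; dist z z0 < \<delta>\<rbrakk> \<Longrightarrow> norm (F z - (F z0 + d * (z - z0))) < norm (d * (z - z0))"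
proof -
  have "((\<lambda>z. (F z - F z0) / (z - z0)) \<longlongrightarrow> d) (at z0)"
    using assms(1) by (rule has_field_derivativeD)
  then have "\<forall>\<^sub>F z in at z0. dist ((F z - F z0) / (z - z0)) d < norm d"
    using \<open>d \<noteq> 0\<close> by (intro tendstoD) auto
  then obtain \<delta> where "0 < \<delta>"
    and \<delta>: "\<And>z. \<lbrakk>z \<noteq> z0; dist z z0 < \<delta>\<rbrakk> \<Longrightarrow> dist ((F z - F z0) / (z - z0)) d < norm d"
    by (auto simp: eventually_at)
  have "norm (F z - (F z0 + d * (z - z0))) < norm (d * (z - z0))"
    if z: "z \<noteq> z0" "dist z z0 < \<delta>" for z
  proof -
    have "F z - (F z0 + d * (z - z0)) = ((F z - F z0) / (z - z0) - d) * (z - z0)"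
      using z(1) by (simp add: field_simps)
    then have "norm (F z - (F z0 + d * (z - z0))) =
        norm ((F z - F z0) / (z - z0) - d) * norm (z - z0)"
      by (simp add: norm_mult)
    also have "\<dots> < norm d * norm (z - z0)"
      using \<delta>[OF z] z(1) by (intro mult_strict_right_mono) (auto simp: dist_norm)
    finally show ?thesis
      by (simp add: norm_mult)
  qed
  then show ?thesis
    using that \<open>0 < \<delta>\<close> by blast
qed

lemma winding_number_image_small_circle:
  assumes cont: "continuous_on UNIV F" and der: "(F has_field_derivative d) (at z0)" and "d \<noteq> 0"
  obtains r where "0 < r" "winding_number (F \<circ> circlepath z0 r) (F z0) = 1"
proof -
  obtain \<delta> where "0 < \<delta>" and \<delta>: "\<And>z. \<lbrakk>z \<noteq> z0; dist z z0 < \<delta>\<rbrakk> \<Longrightarrow>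
      norm (F z - (F z0 + d * (z - z0))) < norm (d * (z - z0))"
    using DERIV_linear_approximation[OF der \<open>d \<noteq> 0\<close>] by metis
  define r where "r = \<delta> / 2"
  have r: "0 < r" "r < \<delta>"
    using \<open>0 < \<delta>\<close> by (auto simp: r_def)
  define L where "L z = d * z + (F z0 - d * z0)" for z
  have near: "norm (F z - L z) < norm (L z - F z0)" if "z \<in> sphere z0 r" for z
  proof -
    have "z \<noteq> z0" "dist z z0 < \<delta>"
      using that r by (auto simp: dist_commute)
    moreover have "L z = F z0 + d * (z - z0)"
      by (simp add: L_def algebra_simps)
    ultimately show ?thesis
      using \<delta> by simp
  qed
  have "winding_number (F \<circ> circlepath z0 r) (F z0) = winding_number (L \<circ> circlepath z0 r) (F z0)"
  proof (rule winding_number_nearby_loops_eq)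
    show "path (L \<circ> circlepath z0 r)" "path (F \<circ> circlepath z0 r)"
      unfolding L_def
      by (intro path_continuous_image continuous_intros continuous_on_subset[OF cont]; simp)+
    show "norm ((F \<circ> circlepath z0 r) t - (L \<circ> circlepath z0 r) t)
        < norm ((L \<circ> circlepath z0 r) t - F z0)"
      if "t \<in> {0..1}" for t
      using near circlepath_in_sphere[OF less_imp_le[OF r(1)] that] by simp
  qed (auto simp: pathfinish_compose pathstart_compose)
  also have "\<dots> = winding_number (circlepath z0 r) z0"
    using winding_number_affine[OF \<open>d \<noteq> 0\<close>, of "circlepath z0 r" z0 "F z0 - d * z0"] r(1)
    by (simp add: L_def [abs_def])
  finally show ?thesis
    using that r(1) winding_number_circlepath_centre[OF r(1)] by simp
qed

lemma winding_number_image_large_circle: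
  assumes cont: "continuous_on UNIV F" and lim: "(F \<longlongrightarrow> l) at_infinity" and "l \<noteq> p"
  obtains r where "0 < r" "winding_number (F \<circ> circlepath z0 r) p = 0"
proof -
  have "\<forall>\<^sub>F z in at_infinity. dist (F z) l < dist l p"
    using lim \<open>l \<noteq> p\<close> by (intro tendstoD) auto
  then obtain B where B: "\<And>z. B \<le> norm z \<Longrightarrow> dist (F z) l < dist l p"
    by (auto simp: eventually_at_infinity)
  define r where "r = \<bar>B\<bar> + norm z0 + 1"
  have "0 < r"
    unfolding r_def by (intro add_nonneg_pos) auto
  have near: "norm (F z - l) < norm (l - p)" if "z \<in> sphere z0 r" for z
  proof -
    have "dist z0 z = r"
      using that by simp
    then have "B \<le> norm z"
      using norm_triangle_ineq4[of z0 z] by (simp add: r_def dist_norm)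
    then show ?thesis
      using B by (simp add: dist_norm)
  qed
  have "winding_number (F \<circ> circlepath z0 r) p = winding_number (linepath l l) p"
  proof (rule winding_number_nearby_loops_eq)
    show "path (F \<circ> circlepath z0 r)"
      by (intro path_continuous_image continuous_on_subset[OF cont]) auto
    show "norm ((F \<circ> circlepath z0 r) t - linepath l l t) < norm (linepath l l t - p)"
      if "t \<in> {0..1}" for t
      using near circlepath_in_sphere[OF less_imp_le[OF \<open>0 < r\<close>] that] by (simp add: linepath_refl)
  qed (auto simp: pathfinish_compose pathstart_compose)
  then show ?thesis
    using that \<open>0 < r\<close> \<open>l \<noteq> p\<close> by simp
qed

lemma homotopic_loops_circlepath:
  assumes "0 < r" "0 < R"
  shows "homotopic_loops (- {z0}) (circlepath z0 r) (circlepath z0 R)"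
proof (rule homotopic_loops_linear)
  fix t :: real
  define e where "e = exp (2 * of_real pi * \<i> * of_real t)"
  show "closed_segment (circlepath z0 r t) (circlepath z0 R t) \<subseteq> - {z0}"
  proof
    fix z
    assume "z \<in> closed_segment (circlepath z0 r t) (circlepath z0 R t)"
    then obtain s where s: "0 \<le> s" "s \<le> 1"
      and "z = (1 - s) *\<^sub>R circlepath z0 r t + s *\<^sub>R circlepath z0 R t"
      by (auto simp: in_segment)
    then have "z = z0 + of_real ((1 - s) * r + s * R) * e"
      by (simp add: circlepath e_def scaleR_conv_of_real algebra_simps)
    moreover have "0 < (1 - s) * r + s * R"
      using assms s by (cases "s = 0") (auto intro!: add_nonneg_pos)
    then have "of_real ((1 - s) * r + s * R) * e \<noteq> 0"
      by (simp only: mult_eq_0_iff of_real_eq_0_iff) (simp add: e_def)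
    ultimately show "z \<in> - {z0}"
      by simp
  qed
qed auto

lemma simple_value_attained_again:
  fixes F :: "complex \<Rightarrow> complex"
  assumes cont: "continuous_on UNIV F" and lim: "(F \<longlongrightarrow> l) at_infinity" and l: "l \<noteq> F z0"
    and der: "(F has_field_derivative d) (at z0)" "d \<noteq> 0"
  shows "\<exists>z. z \<noteq> z0 \<and> F z = F z0"
proof (rule ccontr)
  assume "\<not> ?thesis"
  then have avoid: "F \<in> - {z0} \<rightarrow> - {F z0}"
    by auto
  obtain r where r: "0 < r" "winding_number (F \<circ> circlepath z0 r) (F z0) = 1"
    by (rule winding_number_image_small_circle[OF cont der])
  obtain R where R: "0 < R" "winding_number (F \<circ> circlepath z0 R) (F z0) = 0"
    by (rule winding_number_image_large_circle[OF cont lim l])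
  have "homotopic_loops (- {F z0}) (F \<circ> circlepath z0 r) (F \<circ> circlepath z0 R)"
    using homotopic_loops_circlepath[OF r(1) R(1)] continuous_on_subset[OF cont] avoid
    by (rule homotopic_loops_continuous_image) simp
  then show False
    using r(2) R(2) winding_number_homotopic_loops by fastforce
qed

lemma univalent_value_attained_again:
  fixes F :: "complex \<Rightarrow> complex"
  assumes cont: "continuous_on UNIV F" and lim: "(F \<longlongrightarrow> l) at_infinity"
    and hol: "F holomorphic_on S" and "open S" and inj: "inj_on F S" and z0: "z0 \<in> S" "l \<noteq> F z0"
  shows "\<exists>z. z \<noteq> z0 \<and> F z = F z0"
proof (rule simple_value_attained_again[OF cont lim z0(2)])
  show "(F has_field_derivative deriv F z0) (at z0)"
    by (rule holomorphic_derivI[OF hol \<open>open S\<close> z0(1)])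
  show "deriv F z0 \<noteq> 0"
    by (rule holomorphic_injective_imp_regular[OF hol \<open>open S\<close> inj z0(1)])
qed

lemma continuous_extension_over_open_set:
  fixes \<phi> :: "'a::{metric_space,second_countable_topology} \<Rightarrow> 'b::real_inner"
  assumes "open U" "closed X" "U \<subseteq> X" and cont: "continuous_on (X - U) \<phi>"
    and D: "convex D" "D \<noteq> {}" "\<phi> ` frontier U \<subseteq> D"
  obtains F where "continuous_on X F" "\<And>z. z \<notin> U \<Longrightarrow> F z = \<phi> z" "F ` U \<subseteq> D"
proof -
  have "closure U \<subseteq> X"
    using \<open>U \<subseteq> X\<close> \<open>closed X\<close> by (rule closure_minimal)
  then have "frontier U \<subseteq> X - U"
    using \<open>open U\<close> by (auto simp: frontier_def interior_open)
  then have "continuous_on (frontier U) \<phi>"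
    using cont continuous_on_subset by blast
  then obtain g where g: "continuous_on UNIV g" "range g \<subseteq> D" "\<And>z. z \<in> frontier U \<Longrightarrow> g z = \<phi> z"
    using Dugundji[of D UNIV "frontier U" \<phi> thesis] D by auto
  have "continuous_on (closure U \<union> (X - U)) (\<lambda>z. if z \<in> U then g z else \<phi> z)"
    using g(1,3) cont \<open>open U\<close> \<open>closed X\<close>
    by (intro continuous_on_cases)
      (auto simp: frontier_def interior_open intro: continuous_on_subset)
  moreover have "closure U \<union> (X - U) = X"
    using \<open>closure U \<subseteq> X\<close> closure_subset[of U] by auto
  ultimately show ?thesis
    using that[of "\<lambda>z. if z \<in> U then g z else \<phi> z"] g(2) by auto
qed

lemma continuous_extension_over_disjoint_open_sets:
  fixes \<phi> :: "'a::{metric_space,second_countable_topology} \<Rightarrow> 'b::real_inner"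
  assumes "finite I" and "continuous_on (- (\<Union>i\<in>I. U i)) \<phi>"
    and "disjoint_family_on U I" and "\<And>i. i \<in> I \<Longrightarrow> open (U i)"
    and "\<And>i. i \<in> I \<Longrightarrow> convex (D i)" and "\<And>i. i \<in> I \<Longrightarrow> D i \<noteq> {}"
    and "\<And>i. i \<in> I \<Longrightarrow> \<phi> ` frontier (U i) \<subseteq> D i"
  shows "\<exists>F. continuous_on UNIV F \<and> (\<forall>z. z \<notin> (\<Union>i\<in>I. U i) \<longrightarrow> F z = \<phi> z) \<and>
           (\<forall>i\<in>I. F ` U i \<subseteq> D i)"
  using assms
proof (induction I arbitrary: \<phi> rule: finite_induct)
  case (insert i I)
  define W where "W = (\<Union>j\<in>I. U j)"
  have opens: "open (U i)" "open W"
    using insert.prems(3) by (auto simp: W_def)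
  have disj: "U i \<inter> W = {}"
    using insert.prems(2) insert.hyps(2) by (auto simp: W_def disjoint_family_on_insert)
  have "- W - U i = - (\<Union>j\<in>insert i I. U j)"
    by (auto simp: W_def)
  then obtain \<psi> where \<psi>: "continuous_on (- W) \<psi>" "\<And>z. z \<notin> U i \<Longrightarrow> \<psi> z = \<phi> z" "\<psi> ` U i \<subseteq> D i"
    using continuous_extension_over_open_set[of "U i" "- W" \<phi> "D i"] insert.prems opens disj
    by (metis closed_Compl disjoint_eq_subset_Compl insertI1)
  have "\<psi> ` frontier (U j) \<subseteq> D j" if "j \<in> I" for j
  proof -
    have "U i \<inter> closure (U j) = {}"
      using open_Int_closure_eq_empty[OF opens(1)] disj that by (auto simp: W_def)
    then show ?thesis
      using insert.prems(6)[of j] that \<psi>(2) by (fastforce simp: frontier_def)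
  qed
  then have "\<exists>F. continuous_on UNIV F \<and> (\<forall>z. z \<notin> W \<longrightarrow> F z = \<psi> z) \<and> (\<forall>j\<in>I. F ` U j \<subseteq> D j)"
    using insert.prems(3-5) \<psi>(1) disjoint_family_on_mono[OF subset_insertI insert.prems(2)]
    unfolding W_def by (intro insert.IH) auto
  then obtain F where F: "continuous_on UNIV F" "\<And>z. z \<notin> W \<Longrightarrow> F z = \<psi> z" "\<And>j. j \<in> I \<Longrightarrow> F ` U j \<subseteq> D j"
    by blast
  have "F ` U i \<subseteq> D i"
    using F(2) \<psi>(3) disj by fastforce
  then show ?case
    using F \<psi>(2) by (intro exI[of _ F]) (auto simp: W_def)
qed auto

lemma univalent_image_subset_continuous_extension:
  assumes hol: "\<phi> holomorphic_on \<Omega>" and inj: "inj_on \<phi> \<Omega>" and \<Omega>: "- W \<subseteq> \<Omega>"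
    and lim: "(\<phi> \<longlongrightarrow> l) at_infinity" and l: "l \<notin> \<phi> ` \<Omega>" and "bounded W"
    and cont: "continuous_on UNIV F" and F_eq: "\<And>z. z \<notin> W \<Longrightarrow> F z = \<phi> z"
  shows "\<phi> ` (- closure W) \<subseteq> F ` W"
proof clarify
  fix z0
  define N where "N = - closure W"
  assume "z0 \<notin> closure W"
  then have z0: "z0 \<in> N"
    by (simp add: N_def)
  have N: "open N" "N \<subseteq> \<Omega>"
    using \<Omega> closure_subset[of W] by (auto simp: N_def)
  have F_N: "F z = \<phi> z" if "z \<in> N" for z
    using F_eq closure_subset[of W] that by (auto simp: N_def)
  obtain B where "\<And>z. z \<in> W \<Longrightarrow> norm z < B"
    using \<open>bounded W\<close> bounded_pos_less by blast
  then have "\<forall>\<^sub>F z in at_infinity. \<phi> z = F z"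
    unfolding eventually_at_infinity by (metis F_eq not_le)
  then have F_lim: "(F \<longlongrightarrow> l) at_infinity"
    by (rule Lim_transform_eventually[OF lim])
  have "F holomorphic_on N"
    using holomorphic_on_subset[OF hol N(2)] F_N by (metis holomorphic_cong)
  moreover have "inj_on F N"
    using inj_on_subset[OF inj N(2)] F_N by (metis inj_on_cong)
  moreover have "l \<noteq> F z0"
    using l z0 N(2) F_N by auto
  ultimately obtain z where z: "z \<noteq> z0" "F z = \<phi> z0"
    using univalent_value_attained_again[OF cont F_lim _ N(1) _ z0] F_N[OF z0] by metis
  have "z \<in> W"
  proof (rule ccontr)
    assume "z \<notin> W"
    then have "\<phi> z = \<phi> z0" "z \<in> \<Omega>"
      using F_eq z(2) \<Omega> by auto
    then show False
      using inj_onD[OF inj] z0 N(2) z(1) by blast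
  qed
  then show "\<phi> z0 \<in> F ` W"
    using z(2) by force
qed

lemma univalent_image_subset_frontier_hulls:
  assumes hol: "\<phi> holomorphic_on \<Omega>" and inj: "inj_on \<phi> \<Omega>" and \<Omega>: "- (\<Union>i\<in>I. U i) \<subseteq> \<Omega>"
    and lim: "(\<phi> \<longlongrightarrow> l) at_infinity" and l: "l \<notin> \<phi> ` \<Omega>"
    and "finite I" "disjoint_family_on U I"
    and U: "\<And>i. i \<in> I \<Longrightarrow> open (U i)" "\<And>i. i \<in> I \<Longrightarrow> bounded (U i)"
    and D: "\<And>i. i \<in> I \<Longrightarrow> convex (D i)" "\<And>i. i \<in> I \<Longrightarrow> D i \<noteq> {}"
      "\<And>i. i \<in> I \<Longrightarrow> \<phi> ` frontier (U i) \<subseteq> D i"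
  shows "\<phi> ` (- closure (\<Union>i\<in>I. U i)) \<subseteq> (\<Union>i\<in>I. D i)"
proof -
  have "continuous_on (- (\<Union>i\<in>I. U i)) \<phi>"
    using hol \<Omega> holomorphic_on_imp_continuous_on holomorphic_on_subset by blast
  then obtain F where cont: "continuous_on UNIV F"
    and F_eq: "\<And>z. z \<notin> (\<Union>i\<in>I. U i) \<Longrightarrow> F z = \<phi> z" and F_in: "\<And>i. i \<in> I \<Longrightarrow> F ` U i \<subseteq> D i"
    using continuous_extension_over_disjoint_open_sets[of I U \<phi> D] assms by metis
  have "bounded (\<Union>i\<in>I. U i)"
    using \<open>finite I\<close> U(2) by blast
  then have "\<phi> ` (- closure (\<Union>i\<in>I. U i)) \<subseteq> F ` (\<Union>i\<in>I. U i)"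
    using univalent_image_subset_continuous_extension[OF hol inj \<Omega> lim l _ cont F_eq] by blast
  also have "\<dots> \<subseteq> (\<Union>i\<in>I. D i)"
    using F_in by blast
  finally show ?thesis .
qed

section \<open>Sets surrounded by conformal copies of a ring\<close>

lemma sphere_holomorphic_on_tendsto_None:
  assumes hol: "sphere_holomorphic_on f (UNIV - Some ` J)" and "bounded J"
  shows "((\<lambda>z. f (Some z)) \<longlongrightarrow> f None) at_infinity"
proof -
  obtain B where "0 < B" and B: "\<And>z. z \<in> J \<Longrightarrow> norm z < B"
    using \<open>bounded J\<close> bounded_pos_less by blast
  have "ball 0 (inverse B) \<subseteq> {w. chart_inf w \<in> UNIV - Some ` J}"
  proof
    fix w :: complex
    assume w: "w \<in> ball 0 (inverse B)"
    have "inverse w \<notin> J" if "w \<noteq> 0"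
    proof
      assume "inverse w \<in> J"
      then have "inverse (norm w) < B"
        using B norm_inverse by metis
      then show False
        using w that \<open>0 < B\<close> less_imp_inverse_less[of "inverse (norm w)" B] by simp
    qed
    then show "w \<in> {w. chart_inf w \<in> UNIV - Some ` J}"
      by (auto simp: chart_inf_def)
  qed
  then have "(\<lambda>w. f (chart_inf w)) holomorphic_on ball 0 (inverse B)"
    using hol by (auto simp: sphere_holomorphic_on_def intro: holomorphic_on_subset)
  then have "isCont (\<lambda>w. f (chart_inf w)) 0"
    using \<open>0 < B\<close>
    by (metis holomorphic_on_imp_continuous_on continuous_on_eq_continuous_at centre_in_ball
        open_ball inverse_positive_iff_positive)
  then have "((\<lambda>w. f (chart_inf w)) \<longlongrightarrow> f None) (at 0)"
    by (simp add: isCont_def chart_inf_def)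
  moreover have "filterlim inverse (at (0::complex)) at_infinity"
    using filterlim_inverse_at_iff[of "\<lambda>z::complex. z" at_infinity] by (simp add: filterlim_ident)
  ultimately have "((\<lambda>z. f (chart_inf (inverse z))) \<longlongrightarrow> f None) at_infinity"
    by (rule filterlim_compose)
  moreover have "\<forall>\<^sub>F z in at_infinity. f (chart_inf (inverse z)) = f (Some z)"
    using eventually_not_equal_at_infinity[of 0] by eventually_elim (simp add: chart_inf_def)
  ultimately show ?thesis
    by (rule Lim_transform_eventually)
qed

locale conformal_ring_cover =
  fixes J A \<Gamma> :: "complex set" and I :: "nat \<Rightarrow> 'i set"
    and \<beta> :: "'i \<Rightarrow> complex \<Rightarrow> complex" and U :: "'i \<Rightarrow> complex set" and \<rho> :: real
  assumes open_A: "open A"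
    and compact_\<Gamma>: "compact \<Gamma>" and connected_\<Gamma>: "connected \<Gamma>" and \<Gamma>_subset: "\<Gamma> \<subseteq> A"
    and holomorphic_\<beta>: "\<And>i. \<beta> i holomorphic_on A" and inj_on_\<beta>: "\<And>i. inj_on (\<beta> i) A"
    and \<beta>_subset: "\<And>i. \<beta> i ` A \<subseteq> - J" and disjoint_rings: "disjoint_family (\<lambda>i. \<beta> i ` A)"
    and finite_level: "\<And>n. finite (I n)" and disjoint_levels: "disjoint_family I"
    and open_U: "\<And>i. open (U i)" and U_subset: "\<And>i. U i \<subseteq> cball 0 \<rho>"
    and frontier_U: "\<And>i. frontier (U i) \<subseteq> \<beta> i ` \<Gamma>"
    and disjoint_U: "\<And>n. disjoint_family_on U (I n)" and J_subset: "\<And>n. J \<subseteq> (\<Union>i\<in>I n. U i)"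
begin

lemma J_subset_cball: "J \<subseteq> cball 0 \<rho>"
  using J_subset[of 0] U_subset by blast

lemma
  assumes hol: "\<phi> holomorphic_on - J" and inj: "inj_on \<phi> (- J)" and bdd: "bounded (\<phi> ` (- J))"
  shows holomorphic_ring: "(\<phi> \<circ> \<beta> i) holomorphic_on A"
    and fmeasurable_ring: "(\<phi> \<circ> \<beta> i) ` A \<in> fmeasurable lborel"
    and disjoint_ring_images: "disjoint_family (\<lambda>i. (\<phi> \<circ> \<beta> i) ` A)"
proof -
  show hol_ring: "(\<phi> \<circ> \<beta> i) holomorphic_on A"
    by (intro holomorphic_on_compose holomorphic_on_subset[OF hol] holomorphic_\<beta> \<beta>_subset)
  have "inj_on (\<phi> \<circ> \<beta> i) A"
    by (intro comp_inj_on inj_on_\<beta> inj_on_subset[OF inj] \<beta>_subset)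
  with hol_ring have "open ((\<phi> \<circ> \<beta> i) ` A)"
    using open_A by (intro open_mapping_thm3)
  moreover have "bounded ((\<phi> \<circ> \<beta> i) ` A)"
    using \<beta>_subset[of i] by (intro bounded_subset[OF bdd]) auto
  ultimately show "(\<phi> \<circ> \<beta> i) ` A \<in> fmeasurable lborel"
    by (intro fmeasurableI emeasure_bounded_finite) auto
  have "(\<phi> \<circ> \<beta> i) ` A \<inter> (\<phi> \<circ> \<beta> j) ` A = \<phi> ` (\<beta> i ` A \<inter> \<beta> j ` A)" for i j
    unfolding image_comp[symmetric] by (rule inj_on_image_Int[OF inj \<beta>_subset \<beta>_subset, symmetric])
  then show "disjoint_family (\<lambda>i. (\<phi> \<circ> \<beta> i) ` A)"
    using disjoint_rings unfolding disjoint_family_on_def by (metis image_empty)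
qed

lemma area_rings_tendsto_0:
  assumes "\<phi> holomorphic_on - J" and "inj_on \<phi> (- J)" and bdd: "bounded (\<phi> ` (- J))"
  shows "(\<lambda>n. \<Sum>i\<in>I n. measure lborel ((\<phi> \<circ> \<beta> i) ` A)) \<longlonglongrightarrow> 0"
proof -
  define R where "R i = (\<phi> \<circ> \<beta> i) ` A" for i
  define S where "S n = (\<Union>i\<in>I n. R i)" for n
  have fmeas: "R i \<in> fmeasurable lborel" for i
    unfolding R_def by (rule fmeasurable_ring[OF assms])
  have disj: "disjoint_family R"
    unfolding R_def[abs_def] by (rule disjoint_ring_images[OF assms])
  have "R i \<inter> R j = {}" if "i \<in> I m" "j \<in> I n" "m \<noteq> n" for i j m n
    using disjoint_family_onD[OF disj, of i j] disjoint_family_onD[OF disjoint_levels, of m n] that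
    by blast
  then have "disjoint_family S"
    unfolding disjoint_family_on_def S_def by blast
  moreover have "range S \<subseteq> sets lborel"
    unfolding S_def using fmeas finite_level
    by (intro image_subsetI sets.finite_UN fmeasurableD) auto
  moreover have "emeasure lborel (\<Union>n. S n) \<noteq> \<infinity>"
  proof -
    have "bounded (\<Union>n. S n)"
      using \<beta>_subset by (intro bounded_subset[OF bdd]) (auto simp: S_def R_def)
    then show ?thesis
      using emeasure_bounded_finite by force
  qed
  ultimately have "(\<lambda>n. measure lborel (S n)) sums measure lborel (\<Union>n. S n)"
    by (intro measure_UNION)
  then have "(\<lambda>n. measure lborel (S n)) \<longlonglongrightarrow> 0"
    by (intro summable_LIMSEQ_zero sums_summable)
  moreover have "measure lborel (S n) = (\<Sum>i\<in>I n. measure lborel (R i))" for n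
    unfolding S_def using finite_level fmeas disj
    by (intro measure_UNION') (auto simp: pairwise_def disjnt_def disjoint_family_on_def)
  ultimately show ?thesis
    by (simp add: R_def)
qed

lemma image_outside_subset_discs:
  assumes hol: "\<phi> holomorphic_on - J" and inj: "inj_on \<phi> (- J)"
    and lim: "(\<phi> \<longlongrightarrow> l) at_infinity" and l: "l \<notin> \<phi> ` (- J)"
    and D: "\<And>i. convex (D i)" "\<And>i. D i \<noteq> {}" "\<And>i. (\<phi> \<circ> \<beta> i) ` \<Gamma> \<subseteq> D i"
  shows "\<phi> ` (- cball 0 \<rho>) \<subseteq> (\<Union>i\<in>I n. D i)"
proof -
  have "closure (\<Union>i\<in>I n. U i) \<subseteq> cball 0 \<rho>"
    using U_subset by (intro closure_minimal) auto
  then have "\<phi> ` (- cball 0 \<rho>) \<subseteq> \<phi> ` (- closure (\<Union>i\<in>I n. U i))"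
    by blast
  also have "\<dots> \<subseteq> (\<Union>i\<in>I n. D i)"
  proof (rule univalent_image_subset_frontier_hulls[OF hol inj _ lim l])
    show "\<phi> ` frontier (U i) \<subseteq> D i" for i
      using frontier_U[of i] D(3)[of i] by (auto simp: image_subset_iff)
    show "bounded (U i)" for i
      by (rule bounded_subset[OF bounded_cball U_subset])
  qed (use finite_level disjoint_U open_U J_subset[of n] D in auto)
  finally show ?thesis .
qed

lemma open_image_outside:
  assumes "\<phi> holomorphic_on - J" "inj_on \<phi> (- J)"
  shows "open (\<phi> ` (- cball 0 \<rho>))"
  using Compl_anti_mono[OF J_subset_cball] assms holomorphic_on_subset inj_on_subset
  by (intro open_mapping_thm3) blast+

lemma measure_image_outside_le:
  assumes hol: "\<phi> holomorphic_on - J" and inj: "inj_on \<phi> (- J)" and bdd: "bounded (\<phi> ` (- J))"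
    and lim: "(\<phi> \<longlongrightarrow> l) at_infinity" and l: "l \<notin> \<phi> ` (- J)"
  obtains C where "\<And>n. measure lborel (\<phi> ` (- cball 0 \<rho>)) \<le>
    C * (\<Sum>i\<in>I n. measure lborel ((\<phi> \<circ> \<beta> i) ` A))"
proof -
  obtain C where C: "\<And>F. \<lbrakk>F holomorphic_on A; F ` A \<in> fmeasurable lborel\<rbrakk> \<Longrightarrow>
      \<exists>p r. 0 \<le> r \<and> F ` \<Gamma> \<subseteq> cball p r \<and> measure lborel (cball p r) \<le> C * measure lborel (F ` A)"
    using image_subset_cball_area[OF open_A compact_\<Gamma> connected_\<Gamma> \<Gamma>_subset] by metis
  have "\<forall>i. \<exists>p r. 0 \<le> r \<and> (\<phi> \<circ> \<beta> i) ` \<Gamma> \<subseteq> cball p r \<and>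
      measure lborel (cball p r) \<le> C * measure lborel ((\<phi> \<circ> \<beta> i) ` A)"
    using C holomorphic_ring[OF hol inj bdd] fmeasurable_ring[OF hol inj bdd] by blast
  then obtain p r where r: "\<And>i. 0 \<le> r i" and \<Gamma>: "\<And>i. (\<phi> \<circ> \<beta> i) ` \<Gamma> \<subseteq> cball (p i) (r i)"
    and disc: "\<And>i. measure lborel (cball (p i) (r i)) \<le> C * measure lborel ((\<phi> \<circ> \<beta> i) ` A)"
    by metis
  have "measure lborel (\<phi> ` (- cball 0 \<rho>)) \<le> C * (\<Sum>i\<in>I n. measure lborel ((\<phi> \<circ> \<beta> i) ` A))" for n
  proof -
    have "\<phi> ` (- cball 0 \<rho>) \<subseteq> (\<Union>i\<in>I n. cball (p i) (r i))"
      using r \<Gamma> by (intro image_outside_subset_discs[OF hol inj lim l]) (auto simp: not_less)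
    then have "measure lborel (\<phi> ` (- cball 0 \<rho>)) \<le> measure lborel (\<Union>i\<in>I n. cball (p i) (r i))"
      using open_image_outside[OF hol inj] finite_level
      by (intro measure_mono_fmeasurable fmeasurable_compact compact_UN) auto
    also have "\<dots> \<le> (\<Sum>i\<in>I n. measure lborel (cball (p i) (r i)))"
      using finite_level by (intro measure_UNION_le) auto
    also have "\<dots> \<le> (\<Sum>i\<in>I n. C * measure lborel ((\<phi> \<circ> \<beta> i) ` A))"
      by (intro sum_mono disc)
    finally show ?thesis
      by (simp add: sum_distrib_left)
  qed
  then show ?thesis
    by (rule that)
qed

lemma univalent_unbounded:
  assumes hol: "\<phi> holomorphic_on - J" and inj: "inj_on \<phi> (- J)"
    and lim: "(\<phi> \<longlongrightarrow> l) at_infinity" and l: "l \<notin> \<phi> ` (- J)"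
  shows "\<not> bounded (\<phi> ` (- J))"
proof
  assume bdd: "bounded (\<phi> ` (- J))"
  let ?out = "\<phi> ` (- cball 0 \<rho>)"
  obtain C where C: "\<And>n. measure lborel ?out \<le> C * (\<Sum>i\<in>I n. measure lborel ((\<phi> \<circ> \<beta> i) ` A))"
    using measure_image_outside_le[OF hol inj bdd lim l] by metis
  have "(\<lambda>n. C * (\<Sum>i\<in>I n. measure lborel ((\<phi> \<circ> \<beta> i) ` A))) \<longlonglongrightarrow> 0"
    by (rule tendsto_mult_right_zero[OF area_rings_tendsto_0[OF hol inj bdd]])
  then have "measure lborel ?out \<le> 0"
    using C by (intro LIMSEQ_le_const[where a = "measure lborel ?out"]) auto
  moreover have "0 < measure lborel ?out"
  proof (rule measure_open_pos)
    show "open ?out"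
      by (rule open_image_outside[OF hol inj])
    show "bounded ?out"
      using J_subset_cball by (intro bounded_subset[OF bdd]) blast
    show "?out \<noteq> {}"
      using not_bounded_UNIV[where 'a = complex] bounded_cball[of "0::complex" \<rho>]
      by (metis double_compl Compl_empty_eq image_is_empty)
  qed
  ultimately show False
    by simp
qed

lemma sphere_univalent_unbounded:
  assumes hol: "sphere_holomorphic_on f (UNIV - Some ` J)" and inj: "inj_on f (UNIV - Some ` J)"
  shows "\<not> bounded (f ` (UNIV - Some ` J))"
proof -
  have sub: "Some ` (- J) \<subseteq> UNIV - Some ` J" and None: "None \<in> UNIV - Some ` J"
    by auto
  have "((\<lambda>z. f (Some z)) \<longlongrightarrow> f None) at_infinity"
    using hol bounded_subset[OF bounded_cball J_subset_cball]
    by (rule sphere_holomorphic_on_tendsto_None)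
  moreover have "(\<lambda>z. f (Some z)) holomorphic_on - J"
  proof -
    have "{z. Some z \<in> UNIV - Some ` J} = - J"
      by auto
    then show ?thesis
      using hol by (simp add: sphere_holomorphic_on_def)
  qed
  moreover have "inj_on (\<lambda>z. f (Some z)) (- J)"
    using inj_onD[OF inj] by (intro inj_onI) auto
  moreover have "f None \<notin> (\<lambda>z. f (Some z)) ` (- J)"
    using inj_onD[OF inj _ None] by auto
  ultimately have "\<not> bounded ((\<lambda>z. f (Some z)) ` (- J))"
    by (intro univalent_unbounded)
  moreover have "(\<lambda>z. f (Some z)) ` (- J) \<subseteq> f ` (UNIV - Some ` J)"
    using sub by auto
  ultimately show ?thesis
    using bounded_subset by blast
qed

end

section \<open>Connected preimages\<close>

lemma image_clopen_vimage:
  fixes p :: "'a::topological_space \<Rightarrow> 'b::topological_space"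
  assumes op: "\<And>U. open U \<Longrightarrow> open (p ` U)" and cl: "\<And>C. closed C \<Longrightarrow> closed (p ` C)"
    and S: "connected S"
    and Y: "openin (top_of_set (p -` S)) Y" "closedin (top_of_set (p -` S)) Y" "Y \<noteq> {}"
  shows "p ` Y = S"
proof -
  obtain U T where U: "open U" "Y = p -` S \<inter> U" and T: "closed T" "Y = p -` S \<inter> T"
    using Y(1,2) by (auto simp: openin_open closedin_closed)
  have "p ` Y = S \<inter> p ` U"
    using U(2) by auto
  then have "openin (top_of_set S) (p ` Y)"
    using openin_open_Int[OF op[OF U(1)], of S] by simp
  moreover have "p ` Y = S \<inter> p ` T"
    using T(2) by auto
  then have "closedin (top_of_set S) (p ` Y)"
    using closedin_closed_Int[OF cl[OF T(1)], of S] by simp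
  ultimately show ?thesis
    using S Y(3) unfolding connected_clopen by blast
qed

lemma connected_vimage_open_closed_map:
  fixes p :: "'a::topological_space \<Rightarrow> 'b::topological_space"
  assumes op: "\<And>U. open U \<Longrightarrow> open (p ` U)" and cl: "\<And>C. closed C \<Longrightarrow> closed (p ` C)"
    and S: "connected S" "s \<in> S" and C: "connected C" "C \<subseteq> p -` S" "p -` {s} \<subseteq> C"
  shows "connected (p -` S)"
  unfolding connected_clopen
proof (intro allI impI, elim conjE)
  have clopen: "C \<subseteq> Y" "C \<noteq> {}"
    if Y: "openin (top_of_set (p -` S)) Y" "closedin (top_of_set (p -` S)) Y" "Y \<noteq> {}" for Y
  proof -
    have "Y \<inter> C \<noteq> {}"
      using image_clopen_vimage[OF op cl S(1) Y] S(2) C(3) by blast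
    moreover obtain U T where U: "open U" "Y = p -` S \<inter> U" and T: "closed T" "Y = p -` S \<inter> T"
      using Y(1,2) by (auto simp: openin_open closedin_closed)
    have "C \<inter> Y = C \<inter> U" "C \<inter> Y = C \<inter> T"
      using U(2) T(2) C(2) by auto
    then have "openin (top_of_set C) (C \<inter> Y)" "closedin (top_of_set C) (C \<inter> Y)"
      using openin_open_Int[OF U(1), of C] closedin_closed_Int[OF T(1), of C] by simp_all
    ultimately show "C \<subseteq> Y" "C \<noteq> {}"
      using C(1) unfolding connected_clopen by blast+
  qed
  fix Y
  assume Y: "openin (top_of_set (p -` S)) Y" "closedin (top_of_set (p -` S)) Y"
  then have Z: "openin (top_of_set (p -` S)) (p -` S - Y)"
    "closedin (top_of_set (p -` S)) (p -` S - Y)"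
    by auto
  have "p -` S - Y = {}" if "Y \<noteq> {}"
    using clopen[OF Y that] clopen[OF Z] by blast
  then show "Y = {} \<or> Y = p -` S"
    using openin_imp_subset[OF Y(1)] by blast
qed

section \<open>Iterates of quadratic maps\<close>

definition escape_radius :: "complex \<Rightarrow> real" where
  "escape_radius c = norm c + 2"

lemma escape_radius_gt_1: "1 < escape_radius c"
  using norm_ge_zero[of c] unfolding escape_radius_def by linarith

lemma norm_quad_map_ge:
  assumes "escape_radius c \<le> norm z"
  shows "2 * norm z \<le> norm (quad_map c z)"
proof -
  have "escape_radius c * norm z \<le> norm z * norm z"
    using assms by (intro mult_right_mono) auto
  moreover have "norm c * 1 \<le> norm c * norm z"
    using assms escape_radius_gt_1[of c] by (intro mult_left_mono) auto
  moreover have "norm (z\<^sup>2) - norm c \<le> norm (z\<^sup>2 + c)"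
    by (rule norm_diff_ineq)
  ultimately show ?thesis
    by (simp add: quad_map_def escape_radius_def norm_mult power2_eq_square distrib_right)
qed

lemma norm_le_norm_quad_map_iter:
  assumes "escape_radius c \<le> norm z"
  shows "norm z \<le> norm ((quad_map c ^^ n) z)"
proof (induction n)
  case (Suc n)
  have "norm z \<le> 2 * norm ((quad_map c ^^ n) z)"
    using Suc norm_ge_zero[of z] by linarith
  also have "\<dots> \<le> norm ((quad_map c ^^ Suc n) z)"
    using norm_quad_map_ge[of c "(quad_map c ^^ n) z"] assms Suc by simp
  finally show ?case .
qed simp

lemma norm_quad_map_iter_ge:
  assumes "escape_radius c \<le> norm z"
  shows "2 ^ n * norm z \<le> norm ((quad_map c ^^ n) z)"
proof (induction n)
  case (Suc n)
  have "escape_radius c \<le> norm ((quad_map c ^^ n) z)"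
    using assms norm_le_norm_quad_map_iter[OF assms, of n] by linarith
  then show ?case
    using Suc norm_quad_map_ge[of c "(quad_map c ^^ n) z"] by simp
qed simp

lemma escape_time_le:
  assumes "escape_radius c < norm ((quad_map c ^^ m) z)"
    and "norm ((quad_map c ^^ n) z) \<le> 2 * escape_radius c"
  shows "n \<le> m"
proof (rule ccontr)
  assume "\<not> n \<le> m"
  then obtain k where "n = Suc (k + m)"
    using less_imp_Suc_add[of m n] by (auto simp: add.commute)
  then have "(quad_map c ^^ n) z = quad_map c ((quad_map c ^^ k) ((quad_map c ^^ m) z))"
    by (simp add: funpow_add)
  moreover have "escape_radius c < norm ((quad_map c ^^ k) ((quad_map c ^^ m) z))"
    using norm_le_norm_quad_map_iter[of c "(quad_map c ^^ m) z" k] assms(1) by linarith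
  ultimately show False
    using norm_quad_map_ge[of c "(quad_map c ^^ k) ((quad_map c ^^ m) z)"] assms(2) by simp
qed

lemma unbounded_quad_map_orbit:
  assumes "escape_radius c < norm ((quad_map c ^^ n) z)"
  shows "\<not> bounded (range (\<lambda>n. (quad_map c ^^ n) z))"
proof
  assume "bounded (range (\<lambda>n. (quad_map c ^^ n) z))"
  then obtain B where B: "\<And>n. norm ((quad_map c ^^ n) z) \<le> B"
    by (auto simp: bounded_iff)
  obtain m where m: "B < 2 ^ m"
    using real_arch_pow[of 2 B] by auto
  have "2 ^ m * 1 \<le> 2 ^ m * norm ((quad_map c ^^ n) z)"
    using assms escape_radius_gt_1[of c] by (intro mult_left_mono) auto
  also have "\<dots> \<le> norm ((quad_map c ^^ (m + n)) z)"
    using norm_quad_map_iter_ge[of c "(quad_map c ^^ n) z" m] assms by (simp add: funpow_add)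
  finally show False
    using B[of "m + n"] m by simp
qed

lemma critical_value_escapes:
  assumes "c \<notin> mandelbrot"
  shows "\<exists>n. escape_radius c < norm ((quad_map c ^^ n) c)"
proof (rule ccontr)
  assume "\<not> ?thesis"
  then have bound: "norm ((quad_map c ^^ n) c) \<le> escape_radius c" for n
    by (simp add: not_less)
  have "norm ((quad_map c ^^ n) 0) \<le> escape_radius c" for n
  proof (cases n)
    case 0
    then show ?thesis
      using escape_radius_gt_1[of c] by simp
  next
    case (Suc j)
    have "(quad_map c ^^ n) 0 = (quad_map c ^^ j) c"
      unfolding Suc funpow_Suc_right by (simp add: quad_map_def)
    then show ?thesis
      using bound by simp
  qed
  then show False
    using assms by (auto simp: mandelbrot_def bounded_iff)
qed

lemma holomorphic_quad_map_iter: "(quad_map c ^^ n) holomorphic_on S"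
proof (induction n)
  case 0
  show ?case
    by (simp add: id_def)
next
  case (Suc n)
  then have "(\<lambda>z. ((quad_map c ^^ n) z)\<^sup>2 + c) holomorphic_on S"
    by (intro holomorphic_intros)
  then show ?case
    by (simp add: quad_map_def[abs_def] o_def)
qed

lemma continuous_quad_map_iter: "continuous_on S (quad_map c ^^ n)"
  by (intro holomorphic_on_imp_continuous_on holomorphic_quad_map_iter)

lemma open_vimage_quad_map_iter: "open S \<Longrightarrow> open ((quad_map c ^^ n) -` S)"
  by (intro open_vimage continuous_quad_map_iter)

lemma closed_vimage_quad_map_iter: "closed S \<Longrightarrow> closed ((quad_map c ^^ n) -` S)"
  by (intro closed_vimage continuous_quad_map_iter)

lemma bounded_vimage_quad_map_iter:
  assumes "bounded S"
  shows "bounded ((quad_map c ^^ n) -` S)"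
proof -
  obtain B where B: "\<And>z. z \<in> S \<Longrightarrow> norm z \<le> B"
    using assms by (auto simp: bounded_iff)
  have "norm z \<le> max B (escape_radius c)" if "(quad_map c ^^ n) z \<in> S" for z
    using B[OF that] norm_le_norm_quad_map_iter[of c z n] by linarith
  then show ?thesis
    by (auto simp: bounded_iff)
qed

lemma compact_vimage_quad_map_iter: "compact S \<Longrightarrow> compact ((quad_map c ^^ n) -` S)"
  by (simp add: compact_eq_bounded_closed bounded_vimage_quad_map_iter closed_vimage_quad_map_iter)

lemma closed_image_quad_map_iter:
  assumes "closed S"
  shows "closed ((quad_map c ^^ n) ` S)"
  using proper_map[of UNIV S UNIV "quad_map c ^^ n"] assms compact_vimage_quad_map_iter by simp

lemma open_image_quad_map:
  assumes "open S"
  shows "open (quad_map c ` S)"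
proof (rule open_mapping_thm[of "quad_map c" UNIV S])
  show "quad_map c holomorphic_on UNIV"
    using holomorphic_quad_map_iter[of 1 c] by simp
  have "quad_map c 0 \<noteq> quad_map c 1"
    by (simp add: quad_map_def)
  then show "\<not> quad_map c constant_on UNIV"
    unfolding constant_on_def by (metis UNIV_I)
qed (use assms in auto)

lemma open_image_quad_map_iter:
  assumes "open S"
  shows "open ((quad_map c ^^ n) ` S)"
proof (induction n)
  case (Suc n)
  then show ?case
    using open_image_quad_map[of "(quad_map c ^^ n) ` S" c] by (simp add: image_comp)
qed (use assms in simp)

lemma julia_subset_vimage: "julia c \<subseteq> (quad_map c ^^ n) -` cball 0 (escape_radius c)"
proof -
  have "filled_julia c \<subseteq> (quad_map c ^^ n) -` cball 0 (escape_radius c)"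
    using unbounded_quad_map_orbit[of c n] by (force simp: filled_julia_def not_less[symmetric])
  then have "closure (filled_julia c) \<subseteq> (quad_map c ^^ n) -` cball 0 (escape_radius c)"
    by (rule closure_minimal) (intro closed_vimage_quad_map_iter closed_cball)
  then show ?thesis
    by (auto simp: julia_def frontier_def)
qed

text \<open>The critical point \<open>0\<close> is the only preimage of \<open>c\<close>.\<close>
lemma connected_vimage_quad_map:
  assumes "connected S" "c \<in> S"
  shows "connected (quad_map c -` S)"
proof (rule connected_vimage_open_closed_map[where C = "{0}"])
  show "closed (quad_map c ` T)" if "closed T" for T
    using closed_image_quad_map_iter[OF that, of 1 c] by simp
qed (use assms open_image_quad_map in \<open>auto simp: quad_map_def\<close>)

lemma connected_vimage_quad_map_iter:
  assumes "connected S" "\<And>j. j < n \<Longrightarrow> (quad_map c ^^ j) c \<in> S"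
  shows "connected ((quad_map c ^^ n) -` S)"
  using assms(2)
proof (induction n)
  case (Suc n)
  have vimage_Suc: "(quad_map c ^^ Suc n) -` S = quad_map c -` ((quad_map c ^^ n) -` S)"
    by (simp add: funpow_Suc_right vimage_comp del: funpow.simps)
  show ?case
    unfolding vimage_Suc using Suc by (intro connected_vimage_quad_map) auto
qed (use assms(1) in simp)

text \<open>Some fibre over the outside of a large disc lies in that outside, which is connected.\<close>
lemma connected_vimage_outside_ball:
  assumes "escape_radius c \<le> r"
  shows "connected ((quad_map c ^^ n) -` (- ball 0 r))"
proof -
  have "bounded ((quad_map c ^^ n) ` cball 0 r)"
    by (intro compact_imp_bounded compact_continuous_image continuous_quad_map_iter compact_cball)
  then obtain B where B: "\<forall>z\<in>cball 0 r. norm ((quad_map c ^^ n) z) \<le> B"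
    by (auto simp: bounded_iff)
  define s where "s = complex_of_real (\<bar>r\<bar> + \<bar>B\<bar> + 1)"
  have s: "r < norm s" "B < norm s"
    unfolding s_def norm_of_real by linarith+
  show ?thesis
  proof (rule connected_vimage_open_closed_map[OF open_image_quad_map_iter
        closed_image_quad_map_iter])
    show "connected (- ball (0::complex) r)" "connected (- ball (0::complex) r)"
      by (simp_all add: connected_complement_bounded_convex)
    show "- ball 0 r \<subseteq> (quad_map c ^^ n) -` (- ball 0 r)"
      using assms norm_le_norm_quad_map_iter order_trans by (simp add: subset_iff not_less) blast
    show "(quad_map c ^^ n) -` {s} \<subseteq> - ball 0 r"
      using B s(2) by (auto simp flip: not_le)
  qed (use s(1) in auto)
qed

lemma connected_vimage_sphere:
  assumes "escape_radius c \<le> r" "connected ((quad_map c ^^ n) -` cball 0 r)"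
  shows "connected ((quad_map c ^^ n) -` sphere 0 r)"
proof -
  let ?in = "(quad_map c ^^ n) -` cball 0 r" and ?out = "(quad_map c ^^ n) -` (- ball 0 r)"
  have "connected (?in \<inter> ?out)"
    using assms(2) connected_vimage_outside_ball[OF assms(1)]
  proof (rule unicoherentD[OF unicoherent_UNIV])
    show "closedin (top_of_set UNIV) ?in" "closedin (top_of_set UNIV) ?out"
      by (simp_all add: closed_vimage_quad_map_iter closed_Compl)
  qed auto
  moreover have "?in \<inter> ?out = (quad_map c ^^ n) -` sphere 0 r"
    by auto
  ultimately show ?thesis
    by simp
qed

section \<open>Inverse branches\<close>

primrec branch :: "(complex \<Rightarrow> complex) \<Rightarrow> bool list \<Rightarrow> complex \<Rightarrow> complex" where
  "branch h [] z = z"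
| "branch h (b # w) z = (if b then h (branch h w z) else - h (branch h w z))"

locale quad_inverse_branch =
  fixes c :: complex and V :: "complex set" and h :: "complex \<Rightarrow> complex"
  assumes critical_value_notin: "c \<notin> V" and vimage_V: "quad_map c -` V \<subseteq> V"
    and holomorphic_h: "h holomorphic_on V" and quad_map_h: "\<And>z. z \<in> V \<Longrightarrow> quad_map c (h z) = z"
begin

lemma quad_map_minus_h: "z \<in> V \<Longrightarrow> quad_map c (- h z) = z"
  using quad_map_h by (simp add: quad_map_def)

lemma branch_in_V: "z \<in> V \<Longrightarrow> branch h w z \<in> V"
proof (induction w)
  case (Cons b w)
  then show ?case
    using vimage_V quad_map_h[of "branch h w z"] quad_map_minus_h[of "branch h w z"] by auto
qed simp

lemma quad_map_branch_Cons: "z \<in> V \<Longrightarrow> quad_map c (branch h (b # w) z) = branch h w z"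
  using branch_in_V[of z w] quad_map_h quad_map_minus_h by simp

lemma quad_map_iter_branch: "z \<in> V \<Longrightarrow> (quad_map c ^^ length w) (branch h w z) = z"
proof (induction w)
  case (Cons b w)
  then show ?case
    using quad_map_branch_Cons[of z b w] by (simp add: funpow_swap1 del: branch.simps)
qed simp

lemma holomorphic_branch: "branch h w holomorphic_on V"
proof (induction w)
  case Nil
  show ?case
    by simp
next
  case (Cons b w)
  have "(h \<circ> branch h w) holomorphic_on V"
    using branch_in_V by (intro holomorphic_on_compose_gen[OF Cons holomorphic_h]) auto
  moreover from this have "(\<lambda>z. - (h \<circ> branch h w) z) holomorphic_on V"
    by (intro holomorphic_intros)
  ultimately show ?case
    by (cases b) (simp_all add: o_def)
qed

lemma inj_on_branch: "inj_on (branch h w) V"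
  by (metis inj_onI quad_map_iter_branch)

lemma branch_surj:
  "(quad_map c ^^ n) x \<in> V \<Longrightarrow> \<exists>w. length w = n \<and> branch h w ((quad_map c ^^ n) x) = x"
proof (induction n arbitrary: x)
  case (Suc n)
  have "(quad_map c ^^ Suc n) x = (quad_map c ^^ n) (quad_map c x)"
    by (simp add: funpow_swap1)
  then obtain w where w: "length w = n" "branch h w ((quad_map c ^^ Suc n) x) = quad_map c x"
    using Suc by metis
  have "quad_map c x \<in> V"
    using branch_in_V[OF Suc.prems, of w] w by simp
  from quad_map_h[OF this] have "(h (quad_map c x))\<^sup>2 = x\<^sup>2"
    by (simp add: quad_map_def)
  then have "x = h (quad_map c x) \<or> x = - h (quad_map c x)"
    by (auto simp: power2_eq_iff)
  then have "branch h (True # w) ((quad_map c ^^ Suc n) x) = x \<or>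
      branch h (False # w) ((quad_map c ^^ Suc n) x) = x"
    unfolding branch.simps w(2) by auto
  then show ?case
    using w(1) by (metis length_Cons)
qed simp

lemma branch_word_unique:
  "\<lbrakk>length w = length w'; branch h w z = branch h w' z'; z \<in> V; z' \<in> V\<rbrakk> \<Longrightarrow> w = w'"
proof (induction w w' rule: list_induct2)
  case (Cons b w b' w')
  have tails: "branch h w z = branch h w' z'"
    using Cons.prems quad_map_branch_Cons by metis
  then have "w = w'"
    using Cons by blast
  moreover have "h (branch h w z) \<noteq> 0"
    using quad_map_h branch_in_V[OF Cons.prems(2), of w] critical_value_notin
    by (force simp: quad_map_def)
  then have "b = b'"
    using Cons.prems(1) tails by (auto split: if_splits)
  ultimately show ?case
    by simp
qed simp

lemma frontier_branch_image:
  assumes "D \<subseteq> T" "compact T" "T \<subseteq> V" "open (branch h w ` D)"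
  shows "frontier (branch h w ` D) \<subseteq> branch h w ` (T - D)"
proof -
  have "compact (branch h w ` T)"
    using assms holomorphic_branch holomorphic_on_imp_continuous_on continuous_on_subset
    by (intro compact_continuous_image) blast+
  then have "closure (branch h w ` D) \<subseteq> branch h w ` T"
    using assms(1) by (intro closure_minimal image_mono compact_imp_closed)
  then have "frontier (branch h w ` D) \<subseteq> branch h w ` T - branch h w ` D"
    using assms(4) by (auto simp: frontier_def interior_open)
  then show ?thesis
    by blast
qed

end

section \<open>Quadratic maps with escaping critical orbit\<close>

locale escaping_quadratic = quad_inverse_branch c "(quad_map c ^^ K) -` ball 0 \<rho>" h for c K \<rho> h +
  assumes escape_radius_less: "escape_radius c < \<rho>" and \<rho>_le: "\<rho> \<le> 2 * escape_radius c"
    and critical_orbit: "\<And>j. j < K \<Longrightarrow> norm ((quad_map c ^^ j) c) \<le> escape_radius c"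
begin

abbreviation outer_disc :: "complex set" where
  "outer_disc \<equiv> (quad_map c ^^ K) -` ball 0 \<rho>"

definition mid_radius :: real where
  "mid_radius = (escape_radius c + \<rho>) / 2"

definition ring :: "complex set" where
  "ring = (quad_map c ^^ K) -` (ball 0 \<rho> - cball 0 (escape_radius c))"

definition level_curve :: "complex set" where
  "level_curve = (quad_map c ^^ K) -` sphere 0 mid_radius"

definition inner_disc :: "complex set" where
  "inner_disc = (quad_map c ^^ K) -` ball 0 mid_radius"

lemma mid_radius_bounds: "escape_radius c < mid_radius" "mid_radius < \<rho>"
  using escape_radius_less by (simp_all add: mid_radius_def)

lemma subset_outer_disc:
  "ring \<subseteq> outer_disc" "inner_disc \<subseteq> outer_disc"
  "(quad_map c ^^ K) -` cball 0 mid_radius \<subseteq> outer_disc"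
  using mid_radius_bounds by (auto simp: ring_def inner_disc_def)

lemma open_branch_inner_disc: "open (branch h w ` inner_disc)"
proof (rule open_mapping_thm3)
  show "branch h w holomorphic_on inner_disc" "inj_on (branch h w) inner_disc"
    by (rule holomorphic_on_subset[OF holomorphic_branch subset_outer_disc(2)]
        inj_on_subset[OF inj_on_branch subset_outer_disc(2)])+
  show "open inner_disc"
    unfolding inner_disc_def by (intro open_vimage_quad_map_iter open_ball)
qed

lemma quad_map_iter_branch_outer_disc:
  assumes "z \<in> outer_disc"
  shows "(quad_map c ^^ (K + length w)) (branch h w z) = (quad_map c ^^ K) z"
  using quad_map_iter_branch[OF assms] by (simp add: funpow_add)

lemma branch_ring_level:
  assumes "y \<in> branch h w ` ring"
  shows "escape_radius c < norm ((quad_map c ^^ (K + length w)) y)"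
    and "norm ((quad_map c ^^ (K + length w)) y) < \<rho>"
  using assms subset_outer_disc quad_map_iter_branch_outer_disc by (auto simp: ring_def)

lemma branch_ring_subset: "branch h w ` ring \<subseteq> - julia c"
proof
  fix y
  assume "y \<in> branch h w ` ring"
  then show "y \<in> - julia c"
    using branch_ring_level(1) julia_subset_vimage[of c "K + length w"] by fastforce
qed

lemma disjoint_branch_ring: "disjoint_family (\<lambda>w. branch h w ` ring)"
proof -
  have "w = w'" if y: "y \<in> branch h w ` ring" "y \<in> branch h w' ` ring" for w w' y
  proof -
    have "length v \<le> length v'" if "y \<in> branch h v ` ring" "y \<in> branch h v' ` ring" for v v'
      using escape_time_le[OF branch_ring_level(1)[OF that(2)], of "K + length v"]
        branch_ring_level(2)[OF that(1)] \<rho>_le by simp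
    then have "length w = length w'"
      using y by (simp add: le_antisym)
    then show ?thesis
      using y branch_word_unique subset_outer_disc(1) by blast
  qed
  then show ?thesis
    unfolding disjoint_family_on_def by blast
qed

lemma compact_level_curve: "compact level_curve"
  unfolding level_curve_def by (intro compact_vimage_quad_map_iter) simp

lemma connected_level_curve: "connected level_curve"
  unfolding level_curve_def
proof (rule connected_vimage_sphere)
  show "connected ((quad_map c ^^ K) -` cball 0 mid_radius)"
    using critical_orbit mid_radius_bounds(1) by (intro connected_vimage_quad_map_iter) force+
qed (use mid_radius_bounds in simp)

lemma branch_inner_disc_subset: "branch h w ` inner_disc \<subseteq> cball 0 \<rho>"
proof clarify
  fix z
  assume "z \<in> inner_disc"
  then have "norm ((quad_map c ^^ (K + length w)) (branch h w z)) < \<rho>"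
    using quad_map_iter_branch_outer_disc[of z w] subset_outer_disc(2) mid_radius_bounds(2)
    by (auto simp: inner_disc_def)
  then show "branch h w z \<in> cball 0 \<rho>"
    using norm_le_norm_quad_map_iter[of c "branch h w z" "K + length w"] escape_radius_less by force
qed

lemma frontier_branch_inner_disc: "frontier (branch h w ` inner_disc) \<subseteq> branch h w ` level_curve"
proof -
  let ?T = "(quad_map c ^^ K) -` cball 0 mid_radius"
  have "frontier (branch h w ` inner_disc) \<subseteq> branch h w ` (?T - inner_disc)"
  proof (rule frontier_branch_image)
    show "compact ?T"
      by (intro compact_vimage_quad_map_iter compact_cball)
  qed (use subset_outer_disc(3) open_branch_inner_disc in \<open>auto simp: inner_disc_def\<close>)
  moreover have "?T - inner_disc = level_curve"
    by (auto simp: inner_disc_def level_curve_def)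
  ultimately show ?thesis
    by simp
qed

lemma julia_subset_branch_inner_disc: "julia c \<subseteq> (\<Union>w\<in>{w. length w = n}. branch h w ` inner_disc)"
proof
  fix z
  assume "z \<in> julia c"
  then have "norm ((quad_map c ^^ (K + n)) z) < mid_radius"
    using julia_subset_vimage[of c "K + n"] mid_radius_bounds(1) by force
  then have inner: "(quad_map c ^^ n) z \<in> inner_disc"
    by (simp add: inner_disc_def funpow_add)
  then obtain w where "length w = n" "branch h w ((quad_map c ^^ n) z) = z"
    using branch_surj subset_outer_disc(2) by blast
  then show "z \<in> (\<Union>w\<in>{w. length w = n}. branch h w ` inner_disc)"
    using inner by (auto intro!: image_eqI[of z _ "(quad_map c ^^ n) z"])
qed

sublocale conformal_ring_cover "julia c" ring level_curve "\<lambda>n. {w. length w = n}" "branch h"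
  "\<lambda>w. branch h w ` inner_disc" \<rho>
proof
  show "open ring"
    unfolding ring_def by (intro open_vimage_quad_map_iter open_Diff) auto
  show "level_curve \<subseteq> ring"
    using mid_radius_bounds by (auto simp: level_curve_def ring_def)
  show "branch h w holomorphic_on ring" "inj_on (branch h w) ring" for w
    by (rule holomorphic_on_subset[OF holomorphic_branch subset_outer_disc(1)]
        inj_on_subset[OF inj_on_branch subset_outer_disc(1)])+
  show "finite {w :: bool list. length w = n}" for n
    using finite_lists_length_eq[of "UNIV :: bool set" n] by simp
  show "disjoint_family (\<lambda>n. {w :: bool list. length w = n})"
    by (auto simp: disjoint_family_on_def)
  show "disjoint_family_on (\<lambda>w. branch h w ` inner_disc) {w. length w = n}" for n
    using branch_word_unique subset_outer_disc(2) unfolding disjoint_family_on_def by blast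
qed (fact compact_level_curve connected_level_curve branch_ring_subset disjoint_branch_ring
    open_branch_inner_disc branch_inner_disc_subset frontier_branch_inner_disc
    julia_subset_branch_inner_disc)+

end

lemma escaping_inverse_branch_exists:
  assumes \<rho>: "escape_radius c < \<rho>" "\<rho> \<le> norm ((quad_map c ^^ K) c)"
    and orbit: "\<And>j. j < K \<Longrightarrow> norm ((quad_map c ^^ j) c) \<le> escape_radius c"
  obtains h where "h holomorphic_on (quad_map c ^^ K) -` ball 0 \<rho>"
    "\<And>z. z \<in> (quad_map c ^^ K) -` ball 0 \<rho> \<Longrightarrow> quad_map c (h z) = z"
proof -
  define V where "V = (quad_map c ^^ K) -` ball 0 \<rho>"
  have "open V" "bounded V"
    by (simp_all add: V_def open_vimage_quad_map_iter bounded_vimage_quad_map_iter)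
  moreover have "connected V"
    unfolding V_def using orbit \<rho>(1)
    by (intro connected_vimage_quad_map_iter) (auto intro: le_less_trans)
  moreover have "connected (- V)"
    using connected_vimage_outside_ball[of c \<rho> K] \<rho>(1) by (simp add: V_def vimage_Compl)
  ultimately have "simply_connected V"
    by (simp add: simply_connected_iff_simple)
  moreover have "(\<lambda>z. z - c) holomorphic_on V" "\<forall>z\<in>V. z - c \<noteq> 0"
    using \<rho>(2) by (auto simp: V_def intro!: holomorphic_intros)
  ultimately obtain h where h: "h holomorphic_on V" "\<And>z. z \<in> V \<Longrightarrow> z - c = (h z)\<^sup>2"
    using simply_connected_eq_holomorphic_sqrt[OF \<open>open V\<close>] by metis
  have "quad_map c (h z) = z" if "z \<in> V" for z
    using h(2)[OF that] by (metis diff_add_cancel quad_map_def)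
  then show ?thesis
    using that h(1) unfolding V_def by blast
qed

lemma vimage_quad_map_vimage_ball_subset:
  assumes "escape_radius c \<le> \<rho>" "\<rho> \<le> 2 * escape_radius c"
  shows "quad_map c -` (quad_map c ^^ K) -` ball 0 \<rho> \<subseteq> (quad_map c ^^ K) -` ball 0 \<rho>"
proof
  fix z
  assume "z \<in> quad_map c -` (quad_map c ^^ K) -` ball 0 \<rho>"
  then have "norm (quad_map c ((quad_map c ^^ K) z)) < \<rho>"
    by (simp add: funpow_swap1)
  then show "z \<in> (quad_map c ^^ K) -` ball 0 \<rho>"
    using norm_quad_map_ge[of c "(quad_map c ^^ K) z"] assms by force
qed

lemma escaping_quadratic_exists:
  assumes "c \<notin> mandelbrot"
  obtains K \<rho> h where "escaping_quadratic c K \<rho> h"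
proof -
  define K where "K = (LEAST n. escape_radius c < norm ((quad_map c ^^ n) c))"
  have K: "escape_radius c < norm ((quad_map c ^^ K) c)"
    unfolding K_def by (rule LeastI_ex) (rule critical_value_escapes[OF assms])
  have orbit: "norm ((quad_map c ^^ j) c) \<le> escape_radius c" if "j < K" for j
    using not_less_Least that unfolding K_def by fastforce
  define \<rho> where "\<rho> = min (norm ((quad_map c ^^ K) c)) (2 * escape_radius c)"
  have \<rho>: "escape_radius c < \<rho>" "\<rho> \<le> 2 * escape_radius c" "\<rho> \<le> norm ((quad_map c ^^ K) c)"
    using K escape_radius_gt_1[of c] by (auto simp: \<rho>_def)
  obtain h where h: "h holomorphic_on (quad_map c ^^ K) -` ball 0 \<rho>"
    "\<And>z. z \<in> (quad_map c ^^ K) -` ball 0 \<rho> \<Longrightarrow> quad_map c (h z) = z"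
    using escaping_inverse_branch_exists[OF \<rho>(1,3) orbit] by metis
  have "escaping_quadratic c K \<rho> h"
    using \<rho> orbit h vimage_quad_map_vimage_ball_subset[of c \<rho> K] by unfold_locales auto
  then show ?thesis
    by (rule that)
qed

theorem theorem1p3:
  fixes c :: complex
  assumes "c \<notin> mandelbrot"
  shows "\<not> (\<exists>f :: complex option \<Rightarrow> complex.
            sphere_holomorphic_on f (UNIV - Some ` julia c) \<and>
            inj_on f (UNIV - Some ` julia c) \<and>
            bounded (f ` (UNIV - Some ` julia c)))"
proof -
  obtain K \<rho> h where "escaping_quadratic c K \<rho> h"
    using escaping_quadratic_exists[OF assms] .
  then interpret escaping_quadratic c K \<rho> h .
  show ?thesis
    using sphere_univalent_unbounded by blast
qed

end
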